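(* Let $\bm A=(a_{ij})$ be a real $n\times n$ matrix that is strictly diagonally dominant, i.e. $|a_{ii}|>\sum_{j\ne i}|a_{ij}|$ for all $i$, and has non-positive diagonal entries. Write $\bm A=\bm L+\bm D+\bm U$ with $\bm L$ the strictly lower triangular part, $\bm D$ the diagonal and $\bm U$ the strictly upper triangular part of $\bm A$. Then the SDC1 scheme applied to $\dot{\bm u}=\bm A\bm u$, treated as $n$ scalar subsystems, is unconditionally stable: for every $\Delta t>0$ its update matrix $$\bm C=(\bm I-\Delta t\,\bm L-\Delta t\,\bm D)^{-1}(\bm I+\Delta t\,\bm U)$$ satisfies $\rho(\bm C)<1$.
   Context: $\rho$ denotes the spectral radius and $\bm I$ the identity matrix. SDC1 is the first-order partitioned spectral deferred correction scheme with weak Gauss–Seidel coupling predictor; with the coupling term $\bm c(\bm u)=(\bm L+\bm U)\bm u$, one step of size $\Delta t$ for $\dot{\bm u}=\bm A\bm u$ is $\bm u_{n+1}=\bm C\bm u_n$ with $\bm C$ the matrix in the claim, i.e. $u^i_{n+1}=u^i_n+\Delta t\big(\sum_{j\le i}a_{ij}u^j_{n+1}+\sum_{j>i}a_{ij}u^j_n\big)$. *)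

theory Defs
  imports "Jordan_Normal_Form.Spectral_Radius" "Jordan_Normal_Form.Gauss_Jordan_Elimination"
begin

definition strictly_diagonally_dominant :: "real mat \<Rightarrow> bool" where
  "strictly_diagonally_dominant A \<longleftrightarrow>
     (\<forall>i < dim_row A. \<bar>A $$ (i, i)\<bar> > (\<Sum>j \<in> {..<dim_col A} - {i}. \<bar>A $$ (i, j)\<bar>))"

definition strict_lower_part :: "real mat \<Rightarrow> real mat" where
  "strict_lower_part A =
     mat (dim_row A) (dim_col A) (\<lambda>(i, j). if j < i then A $$ (i, j) else 0)"

definition diagonal_part :: "real mat \<Rightarrow> real mat" where
  "diagonal_part A =
     mat (dim_row A) (dim_col A) (\<lambda>(i, j). if i = j then A $$ (i, j) else 0)"

definition strict_upper_part :: "real mat \<Rightarrow> real mat" where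
  "strict_upper_part A =
     mat (dim_row A) (dim_col A) (\<lambda>(i, j). if i < j then A $$ (i, j) else 0)"

lemma lower_diagonal_upper_decomposition:
  "A = strict_lower_part A + diagonal_part A + strict_upper_part A"
  by (rule eq_matI) (auto simp: strict_lower_part_def diagonal_part_def strict_upper_part_def)

(* The system matrix of the implicit part of one step of size h. *)
definition sdc1_implicit_matrix :: "real mat \<Rightarrow> real \<Rightarrow> real mat" where
  "sdc1_implicit_matrix A h =
     1\<^sub>m (dim_row A) - h \<cdot>\<^sub>m strict_lower_part A - h \<cdot>\<^sub>m diagonal_part A"

(* mat_inverse returns None for a singular matrix, so this is the intended product only when
   sdc1_implicit_matrix A h is invertible. *)
definition sdc1_update_matrix :: "real mat \<Rightarrow> real \<Rightarrow> real mat" where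
  "sdc1_update_matrix A h =
     the (mat_inverse (sdc1_implicit_matrix A h)) *
       (1\<^sub>m (dim_row A) + h \<cdot>\<^sub>m strict_upper_part A)"

(* v is a result of one SDC1 step of size h from u, for u' = A u treated as scalar subsystems:
   subsystem i is implicit in itself and uses the new values of the subsystems j < i
   (weak Gauss-Seidel coupling) and the old values of the subsystems j > i. *)
definition sdc1_step :: "real mat \<Rightarrow> real \<Rightarrow> real vec \<Rightarrow> real vec \<Rightarrow> bool" where
  "sdc1_step A h u v \<longleftrightarrow>
     (\<forall>i < dim_row A. v $ i = u $ i +
        h * ((\<Sum>j \<in> {..i}. A $$ (i, j) * v $ j) +
             (\<Sum>j \<in> {i<..<dim_row A}. A $$ (i, j) * u $ j)))"

end

theory Submission
  imports Defs
begin

text \<open>An eigenpair \<open>(\<lambda>, w)\<close> of the update matrix satisfies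
  \<open>\<lambda> (I - h L - h D) w = (I + h U) w\<close>. Read this equation in a row \<open>i\<close> where \<open>|w\<^sub>i|\<close> is
  maximal. If \<open>|\<lambda>| \<ge> 1\<close>, then \<open>a\<^sub>i\<^sub>i \<le> 0\<close> makes the diagonal contribution at least
  \<open>|\<lambda>| h |a\<^sub>i\<^sub>i| |w\<^sub>i|\<close>, whereas the off-diagonal ones amount to at most
  \<open>|\<lambda>| h |w\<^sub>i| (\<Sum>j\<noteq>i. |a\<^sub>i\<^sub>j|)\<close>, which contradicts dominance.\<close>

text \<open>A name for the right factor of \<open>sdc1_update_matrix\<close>, the part of a step
  that acts on the old values.\<close>

definition sdc1_explicit_matrix :: "real mat \<Rightarrow> real \<Rightarrow> real mat" where
  "sdc1_explicit_matrix A h = 1\<^sub>m (dim_row A) + h \<cdot>\<^sub>m strict_upper_part A"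

lemma sdc1_implicit_matrix_carrier [simp]:
  "A \<in> carrier_mat n n \<Longrightarrow> sdc1_implicit_matrix A h \<in> carrier_mat n n"
  by (auto simp: sdc1_implicit_matrix_def strict_lower_part_def diagonal_part_def)

lemma sdc1_explicit_matrix_carrier [simp]:
  "A \<in> carrier_mat n n \<Longrightarrow> sdc1_explicit_matrix A h \<in> carrier_mat n n"
  by (auto simp: sdc1_explicit_matrix_def strict_upper_part_def)

lemma sdc1_implicit_matrix_index:
  assumes "A \<in> carrier_mat n n" "i < n" "j < n"
  shows "sdc1_implicit_matrix A h $$ (i, j) =
    (if i = j then 1 else 0) - (if j \<le> i then h * A $$ (i, j) else 0)"
  using assms
  by (auto simp: sdc1_implicit_matrix_def strict_lower_part_def diagonal_part_def)

lemma sdc1_explicit_matrix_index: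
  assumes "A \<in> carrier_mat n n" "i < n" "j < n"
  shows "sdc1_explicit_matrix A h $$ (i, j) =
    (if i = j then 1 else 0) + (if i < j then h * A $$ (i, j) else 0)"
  using assms by (auto simp: sdc1_explicit_matrix_def strict_upper_part_def)

text \<open>The field is kept general because the formula serves twice: over the reals for the step
  equations and over the complex numbers for eigenvectors.\<close>

lemma sdc1_implicit_matrix_mult_vec_index:
  fixes v :: "'a :: real_normed_field vec"
  assumes A: "A \<in> carrier_mat n n" and v: "v \<in> carrier_vec n" and i: "i < n"
  shows "(map_mat of_real (sdc1_implicit_matrix A h) *\<^sub>v v) $ i =
    v $ i - of_real h * (\<Sum>j\<in>{..i}. of_real (A $$ (i, j)) * v $ j)"
proof -
  have "(map_mat of_real (sdc1_implicit_matrix A h) *\<^sub>v v) $ i =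
      (\<Sum>j\<in>{0..<n}. of_real (sdc1_implicit_matrix A h $$ (i, j)) * v $ j)"
    using i v sdc1_implicit_matrix_carrier[OF A, of h] by (auto simp: scalar_prod_def)
  also have "\<dots> = (\<Sum>j\<in>{0..<n}. (if j = i then v $ j else 0) -
      (if j \<in> {..i} then of_real h * (of_real (A $$ (i, j)) * v $ j) else 0))"
    by (rule sum.cong) (auto simp: sdc1_implicit_matrix_index[OF A i] algebra_simps)
  also have "\<dots> = v $ i - (\<Sum>j\<in>{0..<n} \<inter> {..i}. of_real h * (of_real (A $$ (i, j)) * v $ j))"
    using i unfolding sum_subtractf by (subst sum.inter_restrict[symmetric]) auto
  also have "{0..<n} \<inter> {..i} = {..i}" using i by auto
  finally show ?thesis by (simp add: sum_distrib_left)
qed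

lemma sdc1_explicit_matrix_mult_vec_index:
  fixes v :: "'a :: real_normed_field vec"
  assumes A: "A \<in> carrier_mat n n" and v: "v \<in> carrier_vec n" and i: "i < n"
  shows "(map_mat of_real (sdc1_explicit_matrix A h) *\<^sub>v v) $ i =
    v $ i + of_real h * (\<Sum>j\<in>{i<..<n}. of_real (A $$ (i, j)) * v $ j)"
proof -
  have "(map_mat of_real (sdc1_explicit_matrix A h) *\<^sub>v v) $ i =
      (\<Sum>j\<in>{0..<n}. of_real (sdc1_explicit_matrix A h $$ (i, j)) * v $ j)"
    using i v sdc1_explicit_matrix_carrier[OF A, of h] by (auto simp: scalar_prod_def)
  also have "\<dots> = (\<Sum>j\<in>{0..<n}. (if j = i then v $ j else 0) +
      (if j \<in> {i<..} then of_real h * (of_real (A $$ (i, j)) * v $ j) else 0))"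
    by (rule sum.cong) (auto simp: sdc1_explicit_matrix_index[OF A i] algebra_simps)
  also have "\<dots> = v $ i + (\<Sum>j\<in>{0..<n} \<inter> {i<..}. of_real h * (of_real (A $$ (i, j)) * v $ j))"
    using i unfolding sum.distrib by (subst sum.inter_restrict[symmetric]) auto
  also have "{0..<n} \<inter> {i<..} = {i<..<n}" using i by auto
  finally show ?thesis by (simp add: sum_distrib_left)
qed

text \<open>Over the reals \<open>of_real\<close> simplifies to \<open>id\<close>, so this rule
  specialises the two row formulas to real vectors.\<close>

lemma map_mat_id [simp]: "map_mat id B = B"
  by (rule eq_matI) auto

text \<open>Moving all new values to the left and all old ones to the right turns the row equations
  of the scheme into one linear system.\<close>

lemma sdc1_step_iff:
  assumes A: "A \<in> carrier_mat n n" and u: "u \<in> carrier_vec n" and v: "v \<in> carrier_vec n"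
  shows "sdc1_step A h u v \<longleftrightarrow>
    sdc1_implicit_matrix A h *\<^sub>v v = sdc1_explicit_matrix A h *\<^sub>v u"
proof -
  note M = sdc1_implicit_matrix_carrier[OF A, of h]
  note N = sdc1_explicit_matrix_carrier[OF A, of h]
  have "sdc1_implicit_matrix A h *\<^sub>v v = sdc1_explicit_matrix A h *\<^sub>v u \<longleftrightarrow>
      (\<forall>i<n. (sdc1_implicit_matrix A h *\<^sub>v v) $ i = (sdc1_explicit_matrix A h *\<^sub>v u) $ i)"
    using M N by (simp add: vec_eq_iff del: index_mult_mat_vec)
  also have "\<dots> \<longleftrightarrow> (\<forall>i<n. v $ i - h * (\<Sum>j\<in>{..i}. A $$ (i, j) * v $ j) =
      u $ i + h * (\<Sum>j\<in>{i<..<n}. A $$ (i, j) * u $ j))"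
    using sdc1_implicit_matrix_mult_vec_index[OF A v, of _ h]
      sdc1_explicit_matrix_mult_vec_index[OF A u, of _ h]
    \<comment> \<open>The deleted rule would expand an entry of the product into a scalar product
      with a row before the row formulas could apply.\<close>
    by (simp del: index_mult_mat_vec)
  also have "\<dots> \<longleftrightarrow> sdc1_step A h u v"
    using A by (simp add: sdc1_step_def distrib_left diff_eq_eq add_ac)
  finally show ?thesis by blast
qed

text \<open>The matrix is lower triangular, and its diagonal entries
  \<open>1 - h * A $$ (i, i)\<close> are at least 1.\<close>

lemma det_sdc1_implicit_matrix_nonzero:
  assumes A: "A \<in> carrier_mat n n" and neg: "\<forall>i<n. A $$ (i, i) \<le> 0" and h: "h > 0"
  shows "det (sdc1_implicit_matrix A h) \<noteq> 0"
proof -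
  let ?M = "sdc1_implicit_matrix A h"
  have M: "?M \<in> carrier_mat n n" using A by simp
  have "det ?M = prod_list (diag_mat ?M)"
    by (rule det_lower_triangular[OF _ M]) (auto simp: sdc1_implicit_matrix_index[OF A])
  moreover have "?M $$ (i, i) \<noteq> 0" if "i < n" for i
  proof -
    have "h * A $$ (i, i) \<le> 0" using neg h that by (simp add: mult_nonneg_nonpos)
    then show ?thesis using that by (simp add: sdc1_implicit_matrix_index[OF A])
  qed
  ultimately show ?thesis
    using M by (auto simp: diag_mat_def prod_list_zero_iff)
qed

lemma mat_inverse_det_nonzero:
  fixes M :: "'a :: field mat"
  assumes M: "M \<in> carrier_mat n n" and det: "det M \<noteq> 0"
  obtains P where "mat_inverse M = Some P" "P \<in> carrier_mat n n" "M * P = 1\<^sub>m n" "P * M = 1\<^sub>m n"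
proof (cases "mat_inverse M")
  case None
  have "M \<in> Units (ring_mat TYPE('a) n ())" by (rule det_non_zero_imp_unit[OF M det])
  then show ?thesis using mat_inverse(1)[OF M None, of "()"] by simp
next
  case (Some P)
  then show ?thesis using that mat_inverse(2)[OF M Some] by blast
qed

text \<open>The eigenvalue equation is multiplied through by the implicit matrix, so that no inverse
  appears and single rows can be read off.\<close>

lemma sdc1_eigenvalue_bound:
  fixes w :: "complex vec"
  assumes A: "A \<in> carrier_mat n n" and dom: "strictly_diagonally_dominant A"
    and neg: "\<forall>i<n. A $$ (i, i) \<le> 0" and h: "h > 0"
    and w: "w \<in> carrier_vec n" and w0: "w \<noteq> 0\<^sub>v n"
    and eq: "map_mat of_real (sdc1_explicit_matrix A h) *\<^sub>v w =
      k \<cdot>\<^sub>v (map_mat of_real (sdc1_implicit_matrix A h) *\<^sub>v w)"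
  shows "cmod k < 1"
proof (rule ccontr)
  assume "\<not> cmod k < 1"
  then have k: "cmod k \<ge> 1" by simp
  obtain l where l: "l < n" "w $ l \<noteq> 0" using w w0 by (auto simp: vec_eq_iff)
  define m where "m = Max ((\<lambda>j. cmod (w $ j)) ` {..<n})"
  have "m \<in> (\<lambda>j. cmod (w $ j)) ` {..<n}" unfolding m_def using l by (intro Max_in) auto
  then obtain i where i: "i < n" and mi: "cmod (w $ i) = m" by auto
  have le_m: "cmod (w $ j) \<le> m" if "j < n" for j
    unfolding m_def using that by (intro Max_ge) auto
  have m: "m > 0" using le_m[OF l(1)] l(2) by (smt (verit) zero_less_norm_iff)
  define d where "d = - A $$ (i, i)"
  define p where "p = (\<lambda>j. complex_of_real (A $$ (i, j)) * w $ j)"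
  have d: "d \<ge> 0" using neg i by (simp add: d_def)
  have p_le: "cmod (p j) \<le> \<bar>A $$ (i, j)\<bar> * m" if "j < n" for j
    using le_m[OF that] by (simp add: p_def norm_mult mult_left_mono)
  have "w $ i + of_real h * sum p {i<..<n} = k * (w $ i - of_real h * sum p {..i})"
    using arg_cong[OF eq, of "\<lambda>x. x $ i"] i A sdc1_implicit_matrix_carrier[OF A, of h]
    unfolding sdc1_explicit_matrix_mult_vec_index[OF A w i] p_def
    by (simp add: sdc1_implicit_matrix_mult_vec_index[OF A w i] del: index_mult_mat_vec)
  \<comment> \<open>Splitting off the diagonal term produces the factor \<open>1 + h * d\<close> on
    the left of the next equation.\<close>
  moreover have "sum p {..i} = - of_real d * w $ i + sum p {..<i}"
    by (simp add: lessThan_Suc_atMost[symmetric] p_def d_def)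
  ultimately have "k * of_real (1 + h * d) * w $ i - w $ i =
      of_real h * (k * sum p {..<i} + sum p {i<..<n})"
    by (simp add: algebra_simps)
  then have "cmod (k * of_real (1 + h * d) * w $ i - w $ i) =
      h * cmod (k * sum p {..<i} + sum p {i<..<n})"
    using h by (simp add: norm_mult)
  \<comment> \<open>Only the lower sum carries \<open>k\<close>. Since
    \<open>cmod k \<ge> 1\<close>, the upper sum may be given the same factor, and the two then
    merge into the full off-diagonal row sum.\<close>
  also have "cmod (k * sum p {..<i} + sum p {i<..<n}) \<le>
      cmod k * cmod (sum p {..<i}) + cmod k * cmod (sum p {i<..<n})"
    using k mult_right_mono[OF k, of "cmod (sum p {i<..<n})"]
      norm_triangle_ineq[of "k * sum p {..<i}" "sum p {i<..<n}"]
    by (simp add: norm_mult)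
  also have "\<dots> \<le> cmod k * (\<Sum>j\<in>{..<i}. \<bar>A $$ (i, j)\<bar> * m) +
      cmod k * (\<Sum>j\<in>{i<..<n}. \<bar>A $$ (i, j)\<bar> * m)"
    using i by (intro add_mono mult_left_mono sum_norm_le p_le) auto
  also have "\<dots> = cmod k * m * (\<Sum>j\<in>{..<i} \<union> {i<..<n}. \<bar>A $$ (i, j)\<bar>)"
    by (subst sum.union_disjoint) (auto simp: sum_distrib_left algebra_simps)
  also have "{..<i} \<union> {i<..<n} = {..<n} - {i}" using i by auto
  also have "cmod k * m * (\<Sum>j\<in>{..<n} - {i}. \<bar>A $$ (i, j)\<bar>) < cmod k * m * d"
  proof (rule mult_strict_left_mono)
    show "(\<Sum>j\<in>{..<n} - {i}. \<bar>A $$ (i, j)\<bar>) < d"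
      using dom i A d by (force simp: strictly_diagonally_dominant_def d_def)
    show "cmod k * m > 0" using k m by (intro mult_pos_pos) auto
  qed
  finally have "cmod (k * of_real (1 + h * d) * w $ i - w $ i) < h * (cmod k * m * d)"
    using h by simp
  \<comment> \<open>The reverse triangle inequality bounds the same quantity from below.\<close>
  moreover have "cmod (k * of_real (1 + h * d) * w $ i - w $ i) \<ge>
      cmod k * (1 + h * d) * m - m"
  proof -
    have "cmod (complex_of_real (1 + h * d)) = 1 + h * d"
      using h d by (simp only: norm_of_real) simp
    then have "cmod (k * of_real (1 + h * d) * w $ i) = cmod k * (1 + h * d) * m"
      by (simp only: norm_mult mi)
    then show ?thesis
      using norm_triangle_ineq2[of "k * of_real (1 + h * d) * w $ i" "w $ i"] mi by simp
  qed
  \<comment> \<open>Hence the lower bound is at least \<open>h * (cmod k * m * d)\<close>, which was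
    just shown to be a strict upper bound.\<close>
  moreover have "m \<le> cmod k * m" using k m by simp
  ultimately show False by (simp add: algebra_simps)
qed

theorem mainTheorem2:
  fixes A :: "real mat" and n :: nat
  assumes "n \<ge> 1"
    and "A \<in> carrier_mat n n"
    and "strictly_diagonally_dominant A"
    and "\<forall>i < n. A $$ (i, i) \<le> 0"
  shows "\<forall>h > 0.
           invertible_mat (sdc1_implicit_matrix A h) \<and>
           (\<forall>u \<in> carrier_vec n. \<forall>v \<in> carrier_vec n.
              sdc1_step A h u v \<longleftrightarrow> v = sdc1_update_matrix A h *\<^sub>v u) \<and>
           spectral_radius (map_mat complex_of_real (sdc1_update_matrix A h)) < 1"
proof (intro allI impI conjI ballI)
  fix h :: real
  assume h: "h > 0"
  note A = assms(2)
  let ?M = "sdc1_implicit_matrix A h" and ?N = "sdc1_explicit_matrix A h"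
    and ?C = "sdc1_update_matrix A h"
  have M: "?M \<in> carrier_mat n n" and N: "?N \<in> carrier_mat n n" using A by simp_all
  obtain P where P: "mat_inverse ?M = Some P" "P \<in> carrier_mat n n"
    and MP: "?M * P = 1\<^sub>m n" and PM: "P * ?M = 1\<^sub>m n"
    by (rule mat_inverse_det_nonzero[OF M det_sdc1_implicit_matrix_nonzero[OF A assms(4) h]])
  show "invertible_mat ?M"
    using M P(2) MP PM by (auto simp: invertible_mat_def inverts_mat_def)
  have C_eq: "?C = P * ?N"
    by (simp add: sdc1_update_matrix_def sdc1_explicit_matrix_def P(1))
  have C: "?C \<in> carrier_mat n n" using C_eq P(2) N by simp
  \<comment> \<open>This inverse-free identity gives both the converse direction for the step and
    the eigenvector equation below.\<close>
  have MC: "?M * ?C = ?N"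
    using assoc_mult_mat[OF M P(2) N] MP N by (simp add: C_eq)
  show "sdc1_step A h u v \<longleftrightarrow> v = ?C *\<^sub>v u"
    if u: "u \<in> carrier_vec n" and v: "v \<in> carrier_vec n" for u v
  proof -
    have "?M *\<^sub>v v = ?N *\<^sub>v u \<longleftrightarrow> v = ?C *\<^sub>v u"
    proof
      assume "?M *\<^sub>v v = ?N *\<^sub>v u"
      then have "P *\<^sub>v (?M *\<^sub>v v) = P *\<^sub>v (?N *\<^sub>v u)" by simp
      then show "v = ?C *\<^sub>v u"
        using assoc_mult_mat_vec[OF P(2) M v] assoc_mult_mat_vec[OF P(2) N u] PM v C_eq by simp
    next
      assume "v = ?C *\<^sub>v u"
      then show "?M *\<^sub>v v = ?N *\<^sub>v u" using assoc_mult_mat_vec[OF M C u] MC by simp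
    qed
    then show ?thesis using sdc1_step_iff[OF A u v] by simp
  qed
  let ?c = "map_mat complex_of_real"
  have cC: "?c ?C \<in> carrier_mat n n" and cM: "?c ?M \<in> carrier_mat n n" using C M by simp_all
  \<comment> \<open>As \<open>n \<ge> 1\<close>, the spectrum is nonempty and the spectral radius is
    attained at an eigenvalue.\<close>
  obtain k where k: "eigenvalue (?c ?C) k" "spectral_radius (?c ?C) = cmod k"
    using spectral_radius_mem_max(1)[OF cC] assms(1) by (auto simp: spectrum_def)
  then obtain w where w: "w \<in> carrier_vec n" "w \<noteq> 0\<^sub>v n" and Cw: "?c ?C *\<^sub>v w = k \<cdot>\<^sub>v w"
    using C by (auto simp: eigenvalue_def eigenvector_def)
  \<comment> \<open>The real identity \<open>MC\<close> is carried over to complex matrices by the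
    homomorphism \<open>of_real\<close>, so no complex inverse has to be formed.\<close>
  have "?c ?N *\<^sub>v w = (?c ?M * ?c ?C) *\<^sub>v w"
    using of_real_hom.mat_hom_mult[OF M C] MC by metis
  also have "\<dots> = ?c ?M *\<^sub>v (k \<cdot>\<^sub>v w)" using assoc_mult_mat_vec[OF cM cC w(1)] Cw by simp
  also have "\<dots> = k \<cdot>\<^sub>v (?c ?M *\<^sub>v w)" by (rule mult_mat_vec[OF cM w(1)])
  finally have "cmod k < 1"
    by (rule sdc1_eigenvalue_bound[OF A assms(3,4) h w])
  then show "spectral_radius (?c ?C) < 1" using k by simp
qed

end
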